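(* Let $P_n$ be the path with vertices $v_1,\dots,v_n$, labelled so that $v_1$ and $v_n$ are leaves and $v_j$ and $v_{j+1}$ are adjacent for $j=1,\dots,n-1$, where $n=4k$, $4k+1$, $4k+2$ or $4k+3$. Write $\mathcal{E}(v_j)=\mathcal{E}_{P_n}(v_j)$. Then $$\mathcal{E}(v_1)<\mathcal{E}(v_3)<\mathcal{E}(v_5)<\cdots<\mathcal{E}(v_{2k+1})<\mathcal{E}(v_{2k+2})<\mathcal{E}(v_{2k})<\cdots<\mathcal{E}(v_4)<\mathcal{E}(v_2).$$
   Context: For a graph $G$ with vertices $v_1,\dots,v_n$ and adjacency matrix $A$, the energy of the vertex $v_i$ is $\mathcal{E}_G(v_i)=|A|_{ii}$, the $i$-th diagonal entry of $|A|=(AA^* )^{1/2}$. In the chain the indices run through the odd numbers up to $2k+1$ in increasing order and then through the even numbers from $2k+2$ down to $2$ in decreasing order.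
   Formalization: The printed chain fails for n=4k, 4k+1, 4k+2, since v_j and v_{n+1-j} have equal energy (e.g. in P_4, v_1 and v_4); the formal chain keeps only the indices j ≤ (n+1)/2, which is the full printed chain when n=4k+3. *)

theory Defs
  imports Jordan_Normal_Form.Schur_Decomposition
begin

text \<open>Over \<^typ>\<open>real\<close> the operation \<^const>\<open>conjugate\<close> is the identity; over \<^typ>\<open>complex\<close> the
  order used in the last conjunct is that of Complex\_Order, so it also says that the number is real.\<close>

definition psd_mat :: "'a :: conjugatable_ordered_field mat \<Rightarrow> bool" where
  "psd_mat B \<longleftrightarrow> square_mat B \<and> mat_adjoint B = B \<and>
     (\<forall>v \<in> carrier_vec (dim_row B). 0 \<le> (B *\<^sub>v v) \<bullet>c v)"

text \<open>The description is proper for positive semidefinite real or complex \<open>M\<close>, and in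
  particular for \<open>M = A A\<^sup>*\<close>; no meaning is intended for other \<open>M\<close>.\<close>

definition sqrt_mat :: "'a :: conjugatable_ordered_field mat \<Rightarrow> 'a mat" where
  "sqrt_mat M = (THE B. B \<in> carrier_mat (dim_row M) (dim_row M) \<and> psd_mat B \<and> B * B = M)"

definition abs_mat :: "'a :: conjugatable_ordered_field mat \<Rightarrow> 'a mat" where
  "abs_mat A = sqrt_mat (A * mat_adjoint A)"

text \<open>A simple graph is given by the list of its vertices, without repetition, and by its set of
  edges, which are two-element sets of vertices.\<close>

definition adj_mat :: "'v list \<Rightarrow> 'v set set \<Rightarrow> real mat" where
  "adj_mat vs E = mat (length vs) (length vs) (\<lambda>(i, j). if {vs ! i, vs ! j} \<in> E then 1 else 0)"

text \<open>Vertices are numbered from 1, matrix indices from 0.\<close>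

definition vertex_energy :: "'v list \<Rightarrow> 'v set set \<Rightarrow> nat \<Rightarrow> real" where
  "vertex_energy vs E i = abs_mat (adj_mat vs E) $$ (i - 1, i - 1)"

definition path_vertices :: "nat \<Rightarrow> nat list" where
  "path_vertices n = [1..<Suc n]"

definition path_edges :: "nat \<Rightarrow> nat set set" where
  "path_edges n = {{j, Suc j} | j. 1 \<le> j \<and> j < n}"

definition path_energy :: "nat \<Rightarrow> nat \<Rightarrow> real" where
  "path_energy n = vertex_energy (path_vertices n) (path_edges n)"

text \<open>The list \<open>1, 3, \<dots>, 2k + 1, 2k + 2, 2k, \<dots>, 4, 2\<close>.\<close>

definition chain_indices :: "nat \<Rightarrow> nat list" where
  "chain_indices k = map (\<lambda>i. 2 * i + 1) [0..<Suc k] @ rev (map (\<lambda>i. 2 * i + 2) [0..<Suc k])"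

text \<open>By the reflection of the path, the vertices with the numbers \<open>j\<close> and \<open>n + 1 - j\<close> have the same
  energy. A strict chain over all of \<^term>\<open>chain_indices k\<close> is therefore possible only for
  \<open>n = 4k + 3\<close>; for \<open>n = 4k\<close>, \<open>4k + 1\<close>, \<open>4k + 2\<close> the list contains a vertex together with its
  mirror image (or, for \<open>n = 1\<close>, an index that is no vertex). In the theorem the list is restricted to the
  vertices that are not beyond the middle of the path, \<open>j \<le> (n + 1) / 2\<close>. For \<open>n = 4k + 3\<close>
  this removes nothing:\<close>

lemma filter_chain_indices_full:
  "filter (\<lambda>j. 2 * j \<le> (4 * k + 3) + 1) (chain_indices k) = chain_indices k"
  unfolding chain_indices_def by (subst filter_True) auto

end

theory Submission
  imports Defs
begin

text \<open>Write \<open>N = n + 1\<close> and \<open>h = \<pi> / N\<close>. The symmetric orthogonal matrix with the entries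
  \<open>sqrt (2/N) sin (j r h)\<close> diagonalises the adjacency matrix of the path, with the eigenvalues
  \<open>2 cos (r h)\<close>. Since a positive semidefinite square root is determined by the eigenvectors of its
  square, \<open>|A|\<close> has the same eigenvectors and the eigenvalues \<open>2 |cos (r h)|\<close>. Hence
  \[ E(v_j) = \frac{4}{N} \sum_r \sin^2(jrh) |\cos(rh)|
            = \frac{2}{N} \Bigl(\sum_r |\cos(rh)| - \sum_r \cos(2jrh) |\cos(rh)|\Bigr). \]

  Only the last sum depends on \<open>j\<close>. The sign of \<open>cos (r h)\<close> changes once, in the middle of the range
  of \<open>r\<close>, so the sum splits into cosine sums of Dirichlet type, and these have a closed form
  (lemma \<open>alternating_cos_sum\<close>). The outcome is \<open>E(v_j) = c + (-1)^j d(j)\<close>, where \<open>c\<close> is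
  independent of \<open>j\<close> and, up to the factor \<open>2/N\<close>,
  \[ d(j) = \frac{w(j)}{\cos h - \cos(2jh)}, \qquad
     w(j) = \sin h \mbox{ or } 2 \sin(h/2) \cos(jh), \]
  for even and odd \<open>N\<close> respectively. Up to the middle of the path the numerator is positive and does
  not increase while the denominator is positive and increases strictly, so \<open>d\<close> is positive and
  strictly decreasing. Odd vertices therefore lie below \<open>c\<close> and approach it as \<open>j\<close> grows, even
  vertices lie above \<open>c\<close> and approach it too: this is the asserted chain.\<close>

section \<open>Absolute value of an orthogonally diagonalised real matrix\<close>

lemma mat_adjoint_real: "mat_adjoint (A :: real mat) = transpose_mat A"
  by (rule eq_matI) (auto simp: mat_adjoint_def mat_of_rows_index)

definition orth_diag :: "real mat \<Rightarrow> (nat \<Rightarrow> real) \<Rightarrow> real mat" where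
  "orth_diag U \<mu> = U * mat_diag (dim_col U) \<mu> * transpose_mat U"

lemma orth_diag_carrier:
  assumes "U \<in> carrier_mat n n"
  shows "orth_diag U \<mu> \<in> carrier_mat n n"
  using assms unfolding orth_diag_def by auto

lemma orth_diag_transpose:
  assumes U: "U \<in> carrier_mat n n"
  shows "transpose_mat (orth_diag U \<mu>) = orth_diag U \<mu>"
proof -
  have D: "transpose_mat (mat_diag n \<mu>) = mat_diag n \<mu>"
    by (rule eq_matI) (auto simp: mat_diag_def)
  have "transpose_mat (orth_diag U \<mu>) = U * (mat_diag n \<mu> * transpose_mat U)"
    using U unfolding orth_diag_def
    by (subst transpose_mult[of _ n n _ n]) (auto simp: transpose_mult[of _ n n _ n] D)
  also have "\<dots> = orth_diag U \<mu>"
    using U unfolding orth_diag_def by (subst assoc_mult_mat[of _ n n _ n _ n]) auto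
  finally show ?thesis .
qed

text \<open>For a fixed orthogonal matrix the products multiply the diagonals, so the square root of such a
  matrix can be taken on the diagonal.\<close>

lemma orth_diag_mult:
  assumes U: "U \<in> carrier_mat n n" and orth: "transpose_mat U * U = 1\<^sub>m n"
  shows "orth_diag U \<mu> * orth_diag U \<nu> = orth_diag U (\<lambda>r. \<mu> r * \<nu> r)"
proof -
  let ?T = "transpose_mat U" and ?D = "mat_diag n"
  have T: "?T \<in> carrier_mat n n" using U by auto
  have D: "?D f \<in> carrier_mat n n" for f :: "nat \<Rightarrow> real" by simp
  have "orth_diag U \<mu> * orth_diag U \<nu> = (U * ?D \<mu> * ?T) * (U * (?D \<nu> * ?T))"
    using U T unfolding orth_diag_def by (simp add: assoc_mult_mat[of _ n n _ n _ n])
  also have "\<dots> = U * ?D \<mu> * ((?T * U) * (?D \<nu> * ?T))"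
  proof -
    have Y: "?D \<nu> * ?T \<in> carrier_mat n n" using D T by (rule mult_carrier_mat)
    have X: "U * ?D \<mu> \<in> carrier_mat n n" using U D by (rule mult_carrier_mat)
    show ?thesis
      by (simp only: assoc_mult_mat[OF X T mult_carrier_mat[OF U Y]] assoc_mult_mat[OF T U Y])
  qed
  also have "\<dots> = U * (?D \<mu> * ?D \<nu>) * ?T"
    using U T D left_mult_one_mat[OF mult_carrier_mat[OF D T]] unfolding orth
    by (simp add: assoc_mult_mat[of _ n n _ n _ n] mult_carrier_mat[of _ n n _ n] del: mat_diag_diag)
  finally show ?thesis using U by (simp add: orth_diag_def)
qed

lemma orth_diag_eigenvector:
  assumes U: "U \<in> carrier_mat n n" and orth: "transpose_mat U * U = 1\<^sub>m n" and r: "r < n"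
  shows "orth_diag U \<mu> *\<^sub>v col U r = \<mu> r \<cdot>\<^sub>v col U r"
proof -
  have e: "transpose_mat U *\<^sub>v col U r = unit_vec n r"
    using U r orth by (metis col_mult2 col_one transpose_carrier_mat)
  have d: "mat_diag n \<mu> *\<^sub>v unit_vec n r = \<mu> r \<cdot>\<^sub>v unit_vec n r"
    using r by (intro eq_vecI) (auto simp: mat_diag_def)
  have "orth_diag U \<mu> *\<^sub>v col U r
      = U *\<^sub>v (mat_diag n \<mu> *\<^sub>v (transpose_mat U *\<^sub>v col U r))"
    using U r unfolding orth_diag_def
    by (simp add: assoc_mult_mat_vec[of _ n n _ n] mult_carrier_mat[of _ n n _ n])
  also have "\<dots> = \<mu> r \<cdot>\<^sub>v (U *\<^sub>v unit_vec n r)"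
    using U unfolding e d by (simp add: mult_mat_vec)
  also have "U *\<^sub>v unit_vec n r = col U r"
    using U r by (intro eq_vecI) auto
  finally show ?thesis .
qed

text \<open>The columns of an orthogonal matrix form a basis, so a matrix is determined by its values on them.
  This identifies the adjacency matrix below, and it also makes the square root unique.\<close>

lemma eq_orth_diag_if_eigenvectors:
  assumes U: "U \<in> carrier_mat n n" and orth: "U * transpose_mat U = 1\<^sub>m n"
    and A: "A \<in> carrier_mat n n"
    and eig: "\<And>r. r < n \<Longrightarrow> A *\<^sub>v col U r = \<mu> r \<cdot>\<^sub>v col U r"
  shows "A = orth_diag U \<mu>"
proof -
  have "A * U = U * mat_diag n \<mu>"
  proof (rule mat_col_eqI)
    fix r assume "r < dim_col (U * mat_diag n \<mu>)"
    then have r: "r < n" by (simp add: mat_diag_def)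
    have "col (U * mat_diag n \<mu>) r = \<mu> r \<cdot>\<^sub>v col U r"
      using U r unfolding mat_diag_mult_right[OF U] by (intro eq_vecI) auto
    then show "col (A * U) r = col (U * mat_diag n \<mu>) r"
      using col_mult2[OF A U r] eig[OF r] by (simp only:)
  qed (use A U in \<open>auto simp: mat_diag_def\<close>)
  then have "A * U * transpose_mat U = orth_diag U \<mu>"
    using U unfolding orth_diag_def by simp
  moreover have "A * U * transpose_mat U = A"
    using U A orth by (simp add: assoc_mult_mat[of _ n n _ n _ n])
  ultimately show ?thesis by simp
qed

text \<open>The quadratic form is \<open>\<Sum>r. \<mu> r * (y r)\<^sup>2\<close> in the coordinates \<open>y = U\<^sup>T v\<close>.\<close>

lemma psd_orth_diag:
  assumes U: "U \<in> carrier_mat n n" and nonneg: "\<And>r. r < n \<Longrightarrow> 0 \<le> \<mu> r"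
  shows "psd_mat (orth_diag U \<mu>)"
  unfolding psd_mat_def
proof (intro conjI ballI)
  note B = orth_diag_carrier[OF U, of \<mu>]
  show "square_mat (orth_diag U \<mu>)" using B by auto
  show "mat_adjoint (orth_diag U \<mu>) = orth_diag U \<mu>"
    using U by (simp add: mat_adjoint_real orth_diag_transpose)
  fix v :: "real vec" assume "v \<in> carrier_vec (dim_row (orth_diag U \<mu>))"
  then have v: "v \<in> carrier_vec n" using B by auto
  define y where "y = transpose_mat U *\<^sub>v v"
  have y: "y \<in> carrier_vec n" using U v unfolding y_def by auto
  have dy: "mat_diag n \<mu> *\<^sub>v y = vec n (\<lambda>r. \<mu> r * y $ r)"
    using y by (intro eq_vecI)
      (auto simp: mat_diag_def scalar_prod_def if_distrib[of "\<lambda>x. x * _"] cong: if_cong)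
  have "orth_diag U \<mu> *\<^sub>v v = U *\<^sub>v (mat_diag n \<mu> *\<^sub>v y)"
    using U v unfolding orth_diag_def y_def
    by (simp add: assoc_mult_mat_vec[of _ n n _ n] mult_carrier_mat[of _ n n _ n])
  then have "(orth_diag U \<mu> *\<^sub>v v) \<bullet>c v = (U *\<^sub>v (mat_diag n \<mu> *\<^sub>v y)) \<bullet> v"
    by simp
  also have "\<dots> = v \<bullet> (U *\<^sub>v (mat_diag n \<mu> *\<^sub>v y))"
    using U v dy by (intro comm_scalar_prod[of _ n]) auto
  also have "\<dots> = y \<bullet> (mat_diag n \<mu> *\<^sub>v y)"
    unfolding y_def using U v transpose_vec_mult_scalar[OF U, of "mat_diag n \<mu> *\<^sub>v y" v] dy
    by (simp add: y_def)
  also have "\<dots> = (\<Sum>r<n. \<mu> r * (y $ r)\<^sup>2)"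
    unfolding dy by (simp add: scalar_prod_def lessThan_atLeast0 power2_eq_square mult_ac)
  also have "0 \<le> \<dots>" using nonneg by (intro sum_nonneg) auto
  finally show "0 \<le> (orth_diag U \<mu> *\<^sub>v v) \<bullet>c v" .
qed

text \<open>This is the heart of the uniqueness of square roots. The defect \<open>w = C u - \<beta> u\<close> satisfies
  \<open>C w = - \<beta> w\<close>, because \<open>(C + \<beta>) (C - \<beta>) u = 0\<close>. For \<open>\<beta> > 0\<close> this contradicts semidefiniteness
  unless \<open>w = 0\<close>; for \<open>\<beta> = 0\<close> symmetry gives \<open>w \<bullet> w = (C\<^sup>2 u) \<bullet> u = 0\<close>.\<close>

lemma psd_eigenvector_of_square:
  fixes C :: "real mat"
  assumes C: "C \<in> carrier_mat n n" and psd: "psd_mat C" and u: "u \<in> carrier_vec n"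
    and \<beta>: "0 \<le> \<beta>" and eig: "(C * C) *\<^sub>v u = \<beta>\<^sup>2 \<cdot>\<^sub>v u"
  shows "C *\<^sub>v u = \<beta> \<cdot>\<^sub>v u"
proof -
  define w where "w = C *\<^sub>v u - \<beta> \<cdot>\<^sub>v u"
  have w: "w \<in> carrier_vec n" and Cu: "C *\<^sub>v u \<in> carrier_vec n"
    using C u unfolding w_def by auto
  have CCu: "C *\<^sub>v (C *\<^sub>v u) = \<beta>\<^sup>2 \<cdot>\<^sub>v u" using eig C u by simp
  have sym: "transpose_mat C = C"
    using psd by (simp add: psd_mat_def mat_adjoint_real)
  have "C *\<^sub>v w = \<beta>\<^sup>2 \<cdot>\<^sub>v u - \<beta> \<cdot>\<^sub>v (C *\<^sub>v u)"
    unfolding w_def using C u Cu CCu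
    by (simp add: mult_minus_distrib_mat_vec[of _ n n] mult_mat_vec[of _ n n])
  also have "\<dots> = (- \<beta>) \<cdot>\<^sub>v w"
    unfolding w_def using C u by (intro eq_vecI) (auto simp: algebra_simps power2_eq_square)
  finally have Cw: "C *\<^sub>v w = (- \<beta>) \<cdot>\<^sub>v w" .
  have "w \<bullet> w = 0"
  proof (cases "\<beta> = 0")
    case True
    then have "w = C *\<^sub>v u" unfolding w_def using C u by (intro eq_vecI) auto
    then have "w \<bullet> w = (transpose_mat C *\<^sub>v (C *\<^sub>v u)) \<bullet> u"
      using transpose_vec_mult_scalar[OF C u Cu]  w Cu sym
      by (metis C comm_scalar_prod mult_mat_vec_carrier u)
    then show ?thesis using CCu sym True u by simp
  next
    case False
    have "0 \<le> (C *\<^sub>v w) \<bullet>c w"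
      using psd C w unfolding psd_mat_def by auto
    then have "0 \<le> - \<beta> * (w \<bullet> w)" using w by (simp add: Cw)
    moreover have "0 \<le> w \<bullet> w" using conjugate_square_ge_0_vec[of w] by simp
    ultimately show ?thesis using False \<beta>
      by (simp add: mult_le_0_iff)
  qed
  then have "w = 0\<^sub>v n" using conjugate_square_eq_0_vec[OF w] by simp
  then have "\<And>i. i < n \<Longrightarrow> w $ i = 0" by simp
  then show ?thesis
    unfolding w_def using C u by (intro eq_vecI) auto
qed

lemma abs_mat_orth_diag:
  assumes U: "U \<in> carrier_mat n n" and orth: "U * transpose_mat U = 1\<^sub>m n"
    "transpose_mat U * U = 1\<^sub>m n"
  shows "abs_mat (orth_diag U \<mu>) = orth_diag U (\<lambda>r. \<bar>\<mu> r\<bar>)"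
proof -
  let ?A = "orth_diag U \<mu>" and ?B = "orth_diag U (\<lambda>r. \<bar>\<mu> r\<bar>)"
  have M: "?A * mat_adjoint ?A = orth_diag U (\<lambda>r. \<bar>\<mu> r\<bar>\<^sup>2)"
    by (simp add: mat_adjoint_real orth_diag_transpose[OF U] orth_diag_mult[OF U orth(2)]
        power2_eq_square)
  have dim: "dim_row (orth_diag U f) = n" for f using orth_diag_carrier[OF U, of f] by auto
  show ?thesis
    unfolding abs_mat_def sqrt_mat_def M dim
  proof (rule the_equality)
    show "?B \<in> carrier_mat n n \<and> psd_mat ?B \<and> ?B * ?B = orth_diag U (\<lambda>r. \<bar>\<mu> r\<bar>\<^sup>2)"
      using orth_diag_carrier[OF U] psd_orth_diag[OF U]
      by (simp add: orth_diag_mult[OF U orth(2)] power2_eq_square)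
    fix C assume C: "C \<in> carrier_mat n n \<and> psd_mat C \<and> C * C = orth_diag U (\<lambda>r. \<bar>\<mu> r\<bar>\<^sup>2)"
    show "C = ?B"
    proof (rule eq_orth_diag_if_eigenvectors[OF U orth(1)])
      show "C \<in> carrier_mat n n" using C by simp
      fix r assume r: "r < n"
      have "(C * C) *\<^sub>v col U r = \<bar>\<mu> r\<bar>\<^sup>2 \<cdot>\<^sub>v col U r"
        using C orth_diag_eigenvector[OF U orth(2) r, of "\<lambda>r. \<bar>\<mu> r\<bar>\<^sup>2"] by metis
      moreover have "col U r \<in> carrier_vec n" using U r by auto
      ultimately show "C *\<^sub>v col U r = \<bar>\<mu> r\<bar> \<cdot>\<^sub>v col U r"
        using C by (blast intro: psd_eigenvector_of_square abs_ge_zero)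
    qed
  qed
qed

lemma orth_diag_diagonal_entry:
  assumes U: "U \<in> carrier_mat n n" and i: "i < n"
  shows "orth_diag U \<mu> $$ (i, i) = (\<Sum>r<n. \<mu> r * (U $$ (i, r))\<^sup>2)"
  using U i unfolding orth_diag_def
  by (simp add: mat_diag_mult_right[OF U] scalar_prod_def lessThan_atLeast0
      power2_eq_square mult_ac)

section \<open>Sums of cosines\<close>

text \<open>After multiplication by \<open>2 sin (a/2)\<close> the sum telescopes.\<close>

lemma cos_sum_dirichlet:
  fixes a :: real
  shows "2 * sin (a / 2) * (\<Sum>r<p. cos (real r * a)) = sin ((real p - 1 / 2) * a) + sin (a / 2)"
proof (induction p)
  case 0
  then show ?case by simp
next
  case (Suc p)
  have "2 * sin (a / 2) * cos (real p * a)
      = sin ((real (Suc p) - 1 / 2) * a) - sin ((real p - 1 / 2) * a)"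
  proof -
    have "(real (Suc p) - 1 / 2) * a = real p * a + a / 2"
      "(real p - 1 / 2) * a = real p * a - a / 2" by (simp_all add: field_simps)
    then show ?thesis by (simp add: sin_add sin_diff)
  qed
  then show ?case using Suc by (simp add: algebra_simps)
qed

text \<open>The total angle of the sum is \<open>m\<close> half turns, so only the parity of \<open>m\<close> survives. Even \<open>m\<close> yields the
  orthogonality of the sine vectors, odd \<open>m\<close> the full sums in the closed form of the energy.\<close>

lemma cos_sum_half_turns:
  fixes N m :: nat
  assumes m: "0 < m" "m < 2 * N"
  shows "(\<Sum>r<N. cos (real r * (real m * (pi / N)))) = (1 - (- 1) ^ m) / 2"
proof -
  define a where "a = real m * (pi / N)"
  \<comment> \<open>The bounds on \<open>m\<close> say that the common factor \<open>sin (a/2)\<close> can be cancelled.\<close>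
  have "0 < a / 2" "a / 2 < pi"
    using m by (auto simp: a_def field_simps pos_divide_less_eq)
  then have pos: "0 < sin (a / 2)" by (rule sin_gt_zero)
  have "(real N - 1 / 2) * a = real m * pi - a / 2"
    using m by (simp add: a_def field_simps)
  then have "sin ((real N - 1 / 2) * a) = - ((- 1) ^ m) * sin (a / 2)"
    by (simp add: sin_diff)
  then have "2 * sin (a / 2) * (\<Sum>r<N. cos (real r * a)) = (1 - (- 1) ^ m) * sin (a / 2)"
    using cos_sum_dirichlet[of a N] by (simp add: algebra_simps)
  then have "sin (a / 2) * (2 * (\<Sum>r<N. cos (real r * a))) = sin (a / 2) * (1 - (- 1) ^ m)"
    by (simp only: mult_ac)
  then show ?thesis using pos unfolding a_def by simp
qed

text \<open>The product of sines is half of the difference of the cosines with the multiples \<open>k - j\<close> and \<open>k + j\<close>.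
  These have the same parity, so their sums cancel unless \<open>j = k\<close>.\<close>

lemma sin_orthogonality:
  fixes N j k :: nat
  assumes j: "0 < j" "j < N" and k: "0 < k" "k < N"
  shows "(\<Sum>r<N. sin (real j * real r * (pi / N)) * sin (real r * real k * (pi / N)))
    = (if j = k then N / 2 else 0)"
proof -
  define h where "h = pi / real N"
  have main: "(\<Sum>r<N. sin (real j * real r * h) * sin (real r * real k * h))
      = (if j = k then N / 2 else 0)"
    if j: "0 < j" "j < N" and k: "0 < k" "k < N" and "j \<le> k" for j k
  proof -
    have "sin (real j * real r * h) * sin (real r * real k * h)
        = (cos (real r * (real (k - j) * h)) - cos (real r * (real (j + k) * h))) / 2" for r
    proof -
      have "real r * (real (k - j) * h) = - (real j * real r * h - real r * real k * h)"
        "real r * (real (j + k) * h) = real j * real r * h + real r * real k * h"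
        using \<open>j \<le> k\<close> by (simp_all add: of_nat_diff algebra_simps)
      then show ?thesis by (simp only: sin_times_sin cos_minus)
    qed
    then have "(\<Sum>r<N. sin (real j * real r * h) * sin (real r * real k * h))
        = ((\<Sum>r<N. cos (real r * (real (k - j) * h))) - (\<Sum>r<N. cos (real r * (real (j + k) * h)))) / 2"
      by (simp only: sum_subtractf sum_divide_distrib[symmetric])
    also have "(\<Sum>r<N. cos (real r * (real (j + k) * h))) = (1 - (- 1) ^ (j + k)) / 2"
      unfolding h_def by (rule cos_sum_half_turns) (use j k in auto)
    also have "(\<Sum>r<N. cos (real r * (real (k - j) * h)))
        = (if j = k then N else (1 - (- 1) ^ (j + k)) / 2)"
    proof (cases "j = k")
      case False
      then have "(\<Sum>r<N. cos (real r * (real (k - j) * h))) = (1 - (- 1) ^ (k - j)) / 2"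
        unfolding h_def by (intro cos_sum_half_turns) (use that in auto)
      moreover have "even (k - j) = even (j + k)"
        using that(5) by presburger
      ultimately show ?thesis using False by (simp add: uminus_power_if)
    qed simp
    finally show ?thesis by (cases "j = k") simp_all
  qed
  show ?thesis
  proof (cases "j \<le> k")
    case True
    then show ?thesis using main[OF assms] by (simp add: h_def)
  next
    case False
    then show ?thesis using main[OF k j] by (simp add: h_def mult_ac)
  qed
qed

section \<open>Spectrum of the path\<close>

text \<open>The discrete sine transform of type I. Matrix indices start at 0, so the entry \<open>(i, r)\<close> belongs to the
  vertex \<open>i + 1\<close> and the frequency \<open>r + 1\<close>.\<close>

definition sine_mat :: "nat \<Rightarrow> real mat" where
  "sine_mat n = mat n n (\<lambda>(i, r).
     sqrt (2 / real (Suc n)) * sin (real (Suc i) * real (Suc r) * (pi / real (Suc n))))"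

lemma sine_mat_carrier: "sine_mat n \<in> carrier_mat n n"
  by (simp add: sine_mat_def)

lemma sine_mat_symmetric: "transpose_mat (sine_mat n) = sine_mat n"
  by (rule eq_matI) (auto simp: sine_mat_def mult_ac)

lemma sine_mat_involution: "sine_mat n * sine_mat n = 1\<^sub>m n"
proof (rule eq_matI)
  fix i j assume "i < dim_row (1\<^sub>m n :: real mat)" "j < dim_col (1\<^sub>m n :: real mat)"
  then have ij: "i < n" "j < n" by auto
  let ?N = "Suc n"
  let ?s = "\<lambda>r. sin (real (Suc i) * real r * (pi / ?N)) * sin (real r * real (Suc j) * (pi / ?N))"
  define c where "c = sqrt (2 / real ?N)"
  have "(sine_mat n * sine_mat n) $$ (i, j) = (\<Sum>r<n. c\<^sup>2 * ?s (Suc r))"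
    using ij unfolding sine_mat_def c_def[symmetric]
    by (simp add: scalar_prod_def lessThan_atLeast0 power2_eq_square mult_ac)
  also have "\<dots> = 2 / real ?N * (\<Sum>r<n. ?s (Suc r))"
    by (simp add: sum_distrib_left c_def)
  also have "(\<Sum>r<n. ?s (Suc r)) = (\<Sum>r<?N. ?s r)"
    by (subst sum.lessThan_Suc_shift) simp
  also have "\<dots> = (if i = j then ?N / 2 else 0)"
    using sin_orthogonality[of "Suc i" ?N "Suc j"] ij by simp
  finally show "(sine_mat n * sine_mat n) $$ (i, j) = 1\<^sub>m n $$ (i, j)"
    using ij by simp
qed (auto simp: sine_mat_def)

definition path_mat :: "nat \<Rightarrow> real mat" where
  "path_mat n = adj_mat (path_vertices n) (path_edges n)"

lemma path_mat_eq: "path_mat n = mat n n (\<lambda>(i, l). if l = Suc i \<or> i = Suc l then 1 else 0)"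
proof (rule eq_matI)
  fix i j
  assume "i < dim_row (mat n n (\<lambda>(i, l). if l = Suc i \<or> i = Suc l then 1 else 0 :: real))"
    "j < dim_col (mat n n (\<lambda>(i, l). if l = Suc i \<or> i = Suc l then 1 else 0 :: real))"
  then have ij: "i < n" "j < n" by auto
  have "{Suc i, Suc j} \<in> path_edges n \<longleftrightarrow> j = Suc i \<or> i = Suc j"
    using ij unfolding path_edges_def by (auto simp: doubleton_eq_iff)
  then show "path_mat n $$ (i, j) = mat n n (\<lambda>(i, l). if l = Suc i \<or> i = Suc l then 1 else 0) $$ (i, j)"
    using ij unfolding path_mat_def adj_mat_def path_vertices_def by (simp del: upt_Suc)
qed (auto simp: path_mat_def adj_mat_def path_vertices_def)

text \<open>The boundary values \<open>f 0 = f (n + 1) = 0\<close> stand for the missing neighbours of the two leaves, so that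
  all vertices are treated alike.\<close>

lemma sum_neighbours:
  fixes f :: "nat \<Rightarrow> real"
  assumes i: "i < n" and "f 0 = 0" "f (Suc n) = 0"
  shows "(\<Sum>l<n. (if l = Suc i \<or> i = Suc l then 1 else 0) * f (Suc l)) = f i + f (i + 2)"
proof -
  have "(\<Sum>l<n. (if l = Suc i \<or> i = Suc l then 1 else 0) * f (Suc l))
      = (\<Sum>l<n. (if l = Suc i then f (Suc l) else 0) + (if Suc l = i then f (Suc l) else 0))"
    by (rule sum.cong) auto
  also have "\<dots> = (\<Sum>l<n. if l = Suc i then f (Suc l) else 0) + (\<Sum>l<n. if Suc l = i then f (Suc l) else 0)"
    by (rule sum.distrib)
  also have "(\<Sum>l<n. if l = Suc i then f (Suc l) else 0) = f (i + 2)"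
    using assms by (cases "Suc i = n") auto
  also have "(\<Sum>l<n. if Suc l = i then f (Suc l) else 0) = f i"
    using assms by (cases i) auto
  finally show ?thesis by simp
qed

text \<open>The addition theorem \<open>sin (x - t) + sin (x + t) = 2 cos t sin x\<close> is the eigenvalue equation; the sine
  vanishes at the two fictitious vertices \<open>0\<close> and \<open>n + 1\<close>.\<close>

lemma path_mat_eigenvector:
  assumes r: "r < n"
  shows "path_mat n *\<^sub>v col (sine_mat n) r
    = (2 * cos (real (Suc r) * (pi / real (Suc n)))) \<cdot>\<^sub>v col (sine_mat n) r"
proof (rule eq_vecI)
  fix i assume "i < dim_vec ((2 * cos (real (Suc r) * (pi / real (Suc n)))) \<cdot>\<^sub>v col (sine_mat n) r)"
  then have i: "i < n" by (simp add: sine_mat_def)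
  define t where "t = real (Suc r) * (pi / real (Suc n))"
  define f where "f l = sqrt (2 / real (Suc n)) * sin (real l * t)" for l
  have col: "col (sine_mat n) r $ l = f (Suc l)" if "l < n" for l
    using that r by (simp add: sine_mat_def f_def t_def mult_ac)
  have "real (Suc n) * t = real (Suc r) * pi" by (simp add: t_def)
  then have zero: "f 0 = 0" "f (Suc n) = 0" unfolding f_def by (simp_all only: sin_npi) simp_all
  have "(path_mat n *\<^sub>v col (sine_mat n) r) $ i
      = (\<Sum>l<n. (if l = Suc i \<or> i = Suc l then 1 else 0) * f (Suc l))"
    using i r col unfolding path_mat_eq
    by (simp add: scalar_prod_def lessThan_atLeast0 sine_mat_carrier[THEN carrier_matD(1)])
  also have "\<dots> = f i + f (i + 2)" using i zero by (rule sum_neighbours)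
  also have "\<dots> = 2 * cos t * f (Suc i)"
  proof -
    have "real i * t = real (Suc i) * t - t" "real (i + 2) * t = real (Suc i) * t + t"
      by (simp_all add: algebra_simps)
    then have "sin (real i * t) + sin (real (i + 2) * t) = 2 * cos t * sin (real (Suc i) * t)"
      by (simp only: sin_diff sin_add) simp
    then show ?thesis unfolding f_def by (simp only: distrib_left[symmetric]) simp
  qed
  finally show "(path_mat n *\<^sub>v col (sine_mat n) r) $ i
      = ((2 * cos (real (Suc r) * (pi / real (Suc n)))) \<cdot>\<^sub>v col (sine_mat n) r) $ i"
    using i r col by (simp add: t_def sine_mat_carrier[THEN carrier_matD(1)])
qed (simp add: path_mat_eq sine_mat_def)

text \<open>The diagonal entry of \<open>|A|\<close> weights the absolute eigenvalues by squared eigenvector entries, and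
  \<open>2 sin\<^sup>2 x = 1 - cos (2 x)\<close>. The term \<open>r = 0\<close> is no eigenvalue; it vanishes and completes the
  range to a full period.\<close>

lemma path_energy_eq_spectral_sum:
  assumes j: "1 \<le> j" "j \<le> n"
  defines "h \<equiv> pi / real (Suc n)"
  shows "path_energy n j = 2 / real (Suc n) *
    (\<Sum>r<Suc n. (1 - cos (real r * (real (2 * j) * h))) * \<bar>cos (real r * h)\<bar>)"
proof -
  let ?U = "sine_mat n" and ?\<mu> = "\<lambda>r. 2 * cos (real (Suc r) * h)"
  note U = sine_mat_carrier[of n]
  have orth: "?U * transpose_mat ?U = 1\<^sub>m n" "transpose_mat ?U * ?U = 1\<^sub>m n"
    by (simp_all add: sine_mat_symmetric sine_mat_involution)
  have "path_mat n = orth_diag ?U ?\<mu>"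
    using U orth(1) path_mat_eigenvector unfolding h_def
    by (intro eq_orth_diag_if_eigenvectors) (auto simp: path_mat_eq)
  then have "abs_mat (path_mat n) = orth_diag ?U (\<lambda>r. \<bar>?\<mu> r\<bar>)"
    using abs_mat_orth_diag[OF U orth] by simp
  then have "path_energy n j = orth_diag ?U (\<lambda>r. \<bar>?\<mu> r\<bar>) $$ (j - 1, j - 1)"
    by (simp add: path_energy_def vertex_energy_def path_mat_def)
  also have "\<dots> = (\<Sum>r<n. \<bar>?\<mu> r\<bar> * (?U $$ (j - 1, r))\<^sup>2)"
    using j by (intro orth_diag_diagonal_entry[OF U]) auto
  also have "\<dots> = (\<Sum>r<n. 2 / real (Suc n) *
      ((1 - cos (real (Suc r) * (real (2 * j) * h))) * \<bar>cos (real (Suc r) * h)\<bar>))"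
  proof (rule sum.cong)
    fix r assume "r \<in> {..<n}"
    define x where "x = real j * real (Suc r) * h"
    have "real (Suc r) * (real (2 * j) * h) = 2 * x" by (simp add: x_def)
    then have "1 - cos (real (Suc r) * (real (2 * j) * h)) = 2 * (sin x)\<^sup>2"
      by (simp only: cos_double_sin)
    moreover have "?U $$ (j - 1, r) = sqrt (2 / real (Suc n)) * sin x"
      using \<open>r \<in> _\<close> j by (simp add: sine_mat_def x_def h_def)
    ultimately show "\<bar>?\<mu> r\<bar> * (?U $$ (j - 1, r))\<^sup>2 = 2 / real (Suc n) *
      ((1 - cos (real (Suc r) * (real (2 * j) * h))) * \<bar>cos (real (Suc r) * h)\<bar>)"
      by (simp add: power_mult_distrib abs_mult)
  qed simp
  also have "\<dots> = 2 / real (Suc n) *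
      (\<Sum>r<n. (1 - cos (real (Suc r) * (real (2 * j) * h))) * \<bar>cos (real (Suc r) * h)\<bar>)"
    by (simp add: sum_distrib_left)
  also have "(\<Sum>r<n. (1 - cos (real (Suc r) * (real (2 * j) * h))) * \<bar>cos (real (Suc r) * h)\<bar>)
      = (\<Sum>r<Suc n. (1 - cos (real r * (real (2 * j) * h))) * \<bar>cos (real r * h)\<bar>)"
    by (subst sum.lessThan_Suc_shift) simp
  finally show ?thesis .
qed

section \<open>Closed form of the energy\<close>

text \<open>Up to the factor \<open>2 / N\<close>, the distance between the energy of \<open>v_j\<close> and the value, common to all
  vertices, around which the energies alternate. The parity of \<open>N\<close> matters because \<open>cos (r h)\<close> has a
  zero at some integer \<open>r\<close> only for even \<open>N\<close>.\<close>

definition energy_deviation :: "nat \<Rightarrow> nat \<Rightarrow> real" where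
  "energy_deviation N j = (let h = pi / real N in
     (if even N then sin h else 2 * sin (h / 2) * cos (real j * h)) / (cos h - cos (2 * real j * h)))"

lemma cos_diff_pos:
  assumes j: "1 \<le> j" "2 * j \<le> N"
  shows "0 < cos (pi / real N) - cos (2 * real j * (pi / real N))"
proof -
  have "real (2 * j) \<le> real N" using j by linarith
  then have "2 * real j * (pi / N) \<le> pi" using j by (simp add: field_simps)
  moreover have "pi / N < 2 * real j * (pi / N)" using j by (simp add: field_simps)
  ultimately show ?thesis using j cos_monotone_0_pi[of "pi / N" "2 * real j * (pi / N)"] by simp
qed

text \<open>Below \<open>p\<close>, half of \<open>N\<close> rounded up, the absolute value can be dropped; from \<open>p\<close> on it changes the
  sign. Twice the first half minus the full sum is therefore the quantity sought, and the product
  formula for cosines reduces both to Dirichlet sums with the angles \<open>a = (2j + 1) h\<close> and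
  \<open>b = (2j - 1) h\<close>.\<close>

lemma alternating_cos_sum:
  fixes N j :: nat
  assumes j: "1 \<le> j" "2 * j \<le> N"
  defines "h \<equiv> pi / real N"
  shows "(\<Sum>r<N. cos (real r * (real (2 * j) * h)) * \<bar>cos (real r * h)\<bar>) = - ((- 1) ^ j) * energy_deviation N j"
proof -
  define p where "p = (N + 1) div 2"
  \<comment> \<open>The defect of \<open>(p - 1/2) h\<close>, the angle in the Dirichlet sums up to \<open>p\<close>, from a quarter turn.\<close>
  define \<delta> where "\<delta> = (if even N then h / 2 else 0)"
  define a where "a = real (2 * j + 1) * h"
  define b where "b = real (2 * j - 1) * h"
  define C where "C x p = (\<Sum>r<p. cos (real r * x))" for x :: real and p :: nat
  have N: "0 < N" using j by simp
  have pN: "p \<le> N" using N unfolding p_def by linarith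
  have h: "0 < h" "real N * h = pi" using N by (simp_all add: h_def)
  have pq: "(real p - 1 / 2) * h = pi / 2 - \<delta>"
  proof (cases "even N")
    case True
    then have "2 * p = N" unfolding p_def by auto
    then have "2 * real p * h = pi" using h by (metis of_nat_mult of_nat_numeral)
    then show ?thesis using True by (simp add: \<delta>_def algebra_simps)
  next
    case False
    then have "2 * p = N + 1" unfolding p_def by presburger
    then have "2 * real p = real N + 1" by linarith
    then have "2 * real p * h = pi + h" using h by (simp add: algebra_simps)
    then show ?thesis using False by (simp add: \<delta>_def algebra_simps)
  qed
  define F where "F r = cos (real r * (real (2 * j) * h)) * cos (real r * h)" for r
  have F: "F r = (cos (real r * a) + cos (real r * b)) / 2" for r
  proof -
    have "real r * a = real r * (real (2 * j) * h) + real r * h"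
      "real r * b = real r * (real (2 * j) * h) - real r * h"
      using j by (simp_all add: a_def b_def algebra_simps of_nat_diff)
    then show ?thesis unfolding F_def by (simp only: cos_times_cos add.commute)
  qed
  have sumF: "(\<Sum>r<q. F r) = (C a q + C b q) / 2" for q
    unfolding F C_def by (simp add: sum.distrib sum_divide_distrib[symmetric])
  have abs1: "cos (real r * (real (2 * j) * h)) * \<bar>cos (real r * h)\<bar> = F r" if "r < p" for r
  proof -
    have "2 * r \<le> N" using that unfolding p_def by linarith
    then have "2 * real r * h \<le> real N * h" using h by (intro mult_right_mono) linarith+
    then have "0 \<le> cos (real r * h)" using h by (intro cos_ge_zero) (auto intro: order_trans[of _ 0])
    then show ?thesis by (simp add: F_def)
  qed
  have abs2: "cos (real r * (real (2 * j) * h)) * \<bar>cos (real r * h)\<bar> = - F r" if "p \<le> r" "r < N" for r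
  proof -
    have "N \<le> 2 * r" using that unfolding p_def by linarith
    then have "real N * h \<le> 2 * real r * h" using h by (intro mult_right_mono) linarith+
    then have "pi / 2 \<le> real r * h" using h by simp
    moreover have "real r * h \<le> real N * h" using that h by (intro mult_right_mono) linarith+
    ultimately have "cos (real r * h) \<le> cos (pi / 2)" using h
      by (intro cos_monotone_0_pi_le) auto
    then show ?thesis by (simp add: F_def)
  qed
  have "(\<Sum>r<N. cos (real r * (real (2 * j) * h)) * \<bar>cos (real r * h)\<bar>)
      = (\<Sum>r<p. F r) + (\<Sum>r=p..<N. - F r)"
    unfolding lessThan_atLeast0 sum.atLeastLessThan_concat[OF le0 pN, symmetric]
    using abs1 abs2 by (intro arg_cong2[of _ _ _ _ "(+)"] sum.cong) auto
  also have "\<dots> = 2 * (\<Sum>r<p. F r) - (\<Sum>r<N. F r)"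
    unfolding lessThan_atLeast0 sum.atLeastLessThan_concat[OF le0 pN, of F, symmetric]
    by (simp add: sum_negf)
  also have "(\<Sum>r<N. F r) = 1"
  proof -
    have "C (real m * h) N = 1" if "odd m" "m < 2 * N" for m
      using cos_sum_half_turns[OF odd_pos[OF that(1)] that(2)] that unfolding C_def h_def by simp
    moreover have "odd (2 * j + 1)" "2 * j + 1 < 2 * N" "odd (2 * j - 1)" "2 * j - 1 < 2 * N"
      using j by auto
    ultimately have "C a N = 1" "C b N = 1" unfolding a_def b_def by blast+
    then show ?thesis unfolding sumF by simp
  qed
  finally have S: "(\<Sum>r<N. cos (real r * (real (2 * j) * h)) * \<bar>cos (real r * h)\<bar>)
      = (C a p - 1 / 2) + (C b p - 1 / 2)"
    unfolding sumF by simp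
  have "0 < b / 2" "0 < a / 2" "b / 2 < pi" "a / 2 < pi"
  proof -
    have "real (2 * j + 1) * h < real (2 * N) * h" "real (2 * j - 1) * h < real (2 * N) * h"
      "0 < real (2 * j - 1) * h" "0 < real (2 * j + 1) * h"
      using j h(1) N by (auto intro!: mult_strict_right_mono mult_pos_pos)
    moreover have "real (2 * N) * h = 2 * pi" using h(2) by simp
    ultimately show "0 < b / 2" "0 < a / 2" "b / 2 < pi" "a / 2 < pi"
      by (simp_all only: a_def b_def)
  qed
  then have pos: "0 < sin (a / 2)" "0 < sin (b / 2)" by (simp_all add: sin_gt_zero)
  define u v where "u = real (2 * j + 1) * \<delta>" and "v = real (2 * j - 1) * \<delta>"
  \<comment> \<open>Since \<open>(p - 1/2) a\<close> is \<open>2j + 1\<close> quarter turns up to the defect \<open>u\<close>, the sine becomes \<open>\<plusminus>cos u\<close>;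
    for \<open>b\<close>, with two quarter turns less, the sign is the opposite one.\<close>
  have Ca: "2 * sin (a / 2) * (C a p - 1 / 2) = (- 1) ^ j * cos u"
  proof -
    have "(real p - 1 / 2) * a = real (2 * j + 1) * ((real p - 1 / 2) * h)"
      by (simp add: a_def)
    also have "\<dots> = real j * pi + (pi / 2 - u)"
      unfolding pq u_def by (simp add: algebra_simps)
    finally have "sin ((real p - 1 / 2) * a) = (- 1) ^ j * cos u"
      by (simp only: sin_add[of "real j * pi"] sin_npi cos_npi) (simp add: sin_diff)
    then show ?thesis using cos_sum_dirichlet[of a p] unfolding C_def by (simp add: algebra_simps)
  qed
  have Cb: "2 * sin (b / 2) * (C b p - 1 / 2) = - ((- 1) ^ j * cos v)"
  proof -
    have "(real p - 1 / 2) * b = real (2 * j - 1) * ((real p - 1 / 2) * h)"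
      by (simp add: b_def)
    also have "\<dots> = real j * pi - (pi / 2 + v)"
      unfolding pq v_def using j by (simp add: algebra_simps of_nat_diff)
    finally have "sin ((real p - 1 / 2) * b) = - ((- 1) ^ j * cos v)"
      by (simp only: sin_diff[of "real j * pi"] sin_npi cos_npi) (simp add: sin_add)
    then show ?thesis using cos_sum_dirichlet[of b p] unfolding C_def by (simp add: algebra_simps)
  qed
  have ab: "a / 2 = real j * h + h / 2" "b / 2 = real j * h - h / 2"
    using j by (simp_all add: a_def b_def algebra_simps of_nat_diff add_divide_distrib diff_divide_distrib)
  have D: "2 * sin (a / 2) * sin (b / 2) = cos h - cos (2 * real j * h)"
  proof -
    have "cos h = cos (a / 2 - b / 2)" "cos (2 * real j * h) = cos (a / 2 + b / 2)"
      unfolding ab by (simp_all add: mult_ac)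
    then show ?thesis by (simp add: cos_add cos_diff)
  qed
  have W: "cos v * sin (a / 2) - cos u * sin (b / 2)
      = (if even N then sin h else 2 * sin (h / 2) * cos (real j * h))"
  proof (cases "even N")
    case True
    then have uv: "u = a / 2" "v = b / 2" by (simp_all add: u_def v_def \<delta>_def a_def b_def)
    have "cos v * sin (a / 2) - cos u * sin (b / 2) = sin (a / 2 - b / 2)"
      unfolding uv sin_diff by (simp only: mult.commute)
    also have "a / 2 - b / 2 = h" unfolding ab by simp
    finally show ?thesis using True by simp
  next
    case False
    then have "u = 0" "v = 0" by (simp_all add: u_def v_def \<delta>_def)
    then show ?thesis using False unfolding ab by (simp add: sin_add sin_diff)
  qed
  define X Y where "X = C a p - 1 / 2" and "Y = C b p - 1 / 2"
  have "(X + Y) * (cos h - cos (2 * real j * h))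
      = (2 * sin (a / 2) * X) * sin (b / 2) + (2 * sin (b / 2) * Y) * sin (a / 2)"
    unfolding D[symmetric] by (simp add: algebra_simps)
  also have "\<dots> = - ((- 1) ^ j) * (cos v * sin (a / 2) - cos u * sin (b / 2))"
    unfolding X_def Y_def Ca Cb by (simp add: algebra_simps)
  finally have eq: "(X + Y) * (cos h - cos (2 * real j * h))
      = - ((- 1) ^ j) * (cos v * sin (a / 2) - cos u * sin (b / 2))" .
  have "cos h - cos (2 * real j * h) \<noteq> 0"
    using cos_diff_pos[OF j] unfolding h_def[symmetric] by linarith
  then have "X + Y = - ((- 1) ^ j) * (cos v * sin (a / 2) - cos u * sin (b / 2))
      / (cos h - cos (2 * real j * h))"
    using eq by (rule eq_divide_imp)
  then have "X + Y = - ((- 1) ^ j) * energy_deviation N j"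
    unfolding W energy_deviation_def Let_def h_def[symmetric] by (simp only: times_divide_eq_right)
  then show ?thesis unfolding S X_def Y_def .
qed

lemma path_energy_closed_form:
  assumes j: "1 \<le> j" "2 * j \<le> Suc n"
  defines "N \<equiv> Suc n"
  shows "path_energy n j = 2 / real N *
    ((\<Sum>r<N. \<bar>cos (real r * (pi / real N))\<bar>) + (- 1) ^ j * energy_deviation N j)"
proof -
  have "path_energy n j = 2 / real N * ((\<Sum>r<N. \<bar>cos (real r * (pi / real N))\<bar>)
      - (\<Sum>r<N. cos (real r * (real (2 * j) * (pi / real N))) * \<bar>cos (real r * (pi / real N))\<bar>))"
    using path_energy_eq_spectral_sum[of j n] j
    by (simp only: N_def left_diff_distrib sum_subtractf mult_1)
  also have "(\<Sum>r<N. cos (real r * (real (2 * j) * (pi / real N))) * \<bar>cos (real r * (pi / real N))\<bar>)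
      = - ((- 1) ^ j) * energy_deviation N j"
    using j unfolding N_def by (intro alternating_cos_sum)
  finally show ?thesis by simp
qed

section \<open>Ordering of the energies\<close>

text \<open>For odd \<open>N\<close> the bound \<open>2 j \<le> N\<close> is strict, which makes \<open>cos (j h)\<close> positive.\<close>

lemma energy_deviation_pos:
  assumes j: "1 \<le> j" "2 * j \<le> N"
  shows "0 < energy_deviation N j"
proof -
  define h where "h = pi / real N"
  have h: "0 < h" "real N * h = pi" using j by (simp_all add: h_def)
  have "2 * h \<le> real N * h" using h j by (intro mult_right_mono) linarith+
  then have hpi: "h < pi" using h by linarith
  have "0 < (if even N then sin h else 2 * sin (h / 2) * cos (real j * h))"
  proof (cases "even N")
    case False
    then have "2 * j < N" using j by presburger
    then have "2 * real j * h < real N * h" using h by (intro mult_strict_right_mono) linarith+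
    then have "0 < cos (real j * h)" using h
      by (intro cos_gt_zero_pi) (auto intro: less_le_trans[of _ 0])
    then show ?thesis using False h hpi by (auto intro!: mult_pos_pos sin_gt_zero)
  qed (use h hpi in \<open>auto intro: sin_gt_zero\<close>)
  then show ?thesis using cos_diff_pos[OF j] unfolding energy_deviation_def Let_def h_def by simp
qed

text \<open>Numerator and denominator are monotone in opposite directions because the cosine decreases on
  \<open>[0, \<pi>]\<close>, and \<open>2 j h \<le> \<pi>\<close>.\<close>

lemma energy_deviation_strict_decreasing:
  assumes i: "1 \<le> i" and ij: "i < j" and j: "2 * j \<le> N"
  shows "energy_deviation N j < energy_deviation N i"
proof -
  define h where "h = pi / real N"
  define w where "w l = (if even N then sin h else 2 * sin (h / 2) * cos (real l * h))" for l
  define D where "D l = cos h - cos (2 * real l * h)" for l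
  have gap: "energy_deviation N l = w l / D l" for l
    by (simp add: energy_deviation_def Let_def w_def D_def h_def)
  have h: "0 < h" "real N * h = pi" using i ij j by (simp_all add: h_def)
  have le: "2 * real j * h \<le> pi"
    unfolding h(2)[symmetric] using h j by (intro mult_right_mono) linarith+
  have lt: "real i * h < real j * h" using h ij by simp
  have pos: "0 < D i"
    using cos_diff_pos[of i N] i ij j by (simp add: D_def h_def)
  have "cos (2 * real j * h) < cos (2 * real i * h)"
    using h le lt by (intro cos_monotone_0_pi) auto
  then have "D i < D j" by (simp add: D_def)
  moreover have "cos (real j * h) \<le> cos (real i * h)"
  proof (rule cos_monotone_0_pi_le)
    have "0 \<le> real j * h" using h by simp
    then show "real j * h \<le> pi" using le by linarith
  qed (use h lt in auto)
  moreover have "0 \<le> sin (h / 2)"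
  proof (rule sin_ge_zero)
    have "1 * h \<le> real N * h" using h i ij j by (intro mult_right_mono) linarith+
    then show "h / 2 \<le> pi" using h by linarith
  qed (use h in simp)
  ultimately have wle: "w j \<le> w i" by (simp add: w_def mult_left_mono)
  have "0 < w j / D j" using energy_deviation_pos[of j N] i ij j by (simp add: gap)
  then have "0 < w j" using pos \<open>D i < D j\<close> by (simp add: zero_less_divide_iff)
  then have "w j / D j < w j / D i"
    using pos \<open>D i < D j\<close> by (intro divide_strict_left_mono) auto
  also have "\<dots> \<le> w i / D i" using wle pos by (intro divide_right_mono) auto
  finally show ?thesis by (simp add: gap)
qed

lemma path_energy_less_iff:
  assumes i: "1 \<le> i" "2 * i \<le> Suc n" and j: "1 \<le> j" "2 * j \<le> Suc n"
  shows "path_energy n i < path_energy n j \<longleftrightarrow>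
    (- 1) ^ i * energy_deviation (Suc n) i < (- 1) ^ j * energy_deviation (Suc n) j"
  unfolding path_energy_closed_form[OF i] path_energy_closed_form[OF j]
  by (subst mult_less_cancel_left_pos) simp_all

lemma path_energy_odd_less:
  assumes "odd i" "odd j" "i < j" "2 * j \<le> Suc n"
  shows "path_energy n i < path_energy n j"
proof -
  have "1 \<le> i" using \<open>odd i\<close> by (cases i) auto
  then have "energy_deviation (Suc n) j < energy_deviation (Suc n) i"
    using assms by (intro energy_deviation_strict_decreasing)
  moreover have "path_energy n i < path_energy n j \<longleftrightarrow>
    (- 1) ^ i * energy_deviation (Suc n) i < (- 1) ^ j * energy_deviation (Suc n) j"
    using assms \<open>1 \<le> i\<close> by (intro path_energy_less_iff) linarith+
  ultimately show ?thesis using assms by simp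
qed

lemma path_energy_even_less:
  assumes "even i" "even j" "1 \<le> i" "i < j" "2 * j \<le> Suc n"
  shows "path_energy n j < path_energy n i"
proof -
  have "energy_deviation (Suc n) j < energy_deviation (Suc n) i"
    using assms by (intro energy_deviation_strict_decreasing)
  moreover have "path_energy n j < path_energy n i \<longleftrightarrow>
    (- 1) ^ j * energy_deviation (Suc n) j < (- 1) ^ i * energy_deviation (Suc n) i"
    using assms by (intro path_energy_less_iff) linarith+
  ultimately show ?thesis using assms by simp
qed

lemma path_energy_odd_less_even:
  assumes "odd i" "2 * i \<le> Suc n" "even j" "1 \<le> j" "2 * j \<le> Suc n"
  shows "path_energy n i < path_energy n j"
proof -
  have i: "1 \<le> i" using \<open>odd i\<close> by (cases i) auto
  have "0 < energy_deviation (Suc n) i" "0 < energy_deviation (Suc n) j"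
    using assms i by (simp_all only: energy_deviation_pos)
  moreover have "path_energy n i < path_energy n j \<longleftrightarrow>
    (- 1) ^ i * energy_deviation (Suc n) i < (- 1) ^ j * energy_deviation (Suc n) j"
    using assms i by (intro path_energy_less_iff)
  ultimately show ?thesis using assms by simp
qed

theorem corollary4p10:
  fixes n k :: nat
  assumes "n \<ge> 1"
    and "n = 4 * k \<or> n = 4 * k + 1 \<or> n = 4 * k + 2 \<or> n = 4 * k + 3"
  shows "sorted_wrt (<) (map (path_energy n) (filter (\<lambda>j. 2 * j \<le> n + 1) (chain_indices k)))"
proof -
  let ?P = "\<lambda>j. 2 * j \<le> n + 1" and ?R = "\<lambda>i j. path_energy n i < path_energy n j"
  let ?odds = "map (\<lambda>i. 2 * i + 1) [0..<Suc k]" and ?evens = "map (\<lambda>i. 2 * i + 2) [0..<Suc k]"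
  have "sorted_wrt (<) ?odds" "sorted_wrt (<) ?evens"
    unfolding sorted_wrt_map using sorted_wrt_upt[of 0 "Suc k"]
    by (simp_all del: upt_Suc)
  then have sorted: "sorted_wrt (<) (filter ?P ?odds)" "sorted_wrt (<) (filter ?P ?evens)"
    by (simp_all only: sorted_wrt_filter)
  have odds: "odd i" "2 * i \<le> Suc n" if "i \<in> set (filter ?P ?odds)" for i
    using that unfolding set_filter set_map by force+
  have evens: "even j" "1 \<le> j" "2 * j \<le> Suc n" if "j \<in> set (filter ?P ?evens)" for j
    using that unfolding set_filter set_map by force+
  have "sorted_wrt ?R (filter ?P ?odds)"
  proof (rule sorted_wrt_mono_rel[OF _ sorted(1)])
    fix i j assume "i \<in> set (filter ?P ?odds)" "j \<in> set (filter ?P ?odds)" "i < j"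
    then show "?R i j" using odds(1)[of i] odds[of j] by (intro path_energy_odd_less)
  qed
  moreover have "sorted_wrt (\<lambda>i j. ?R j i) (filter ?P ?evens)"
  proof (rule sorted_wrt_mono_rel[OF _ sorted(2)])
    fix i j assume "i \<in> set (filter ?P ?evens)" "j \<in> set (filter ?P ?evens)" "i < j"
    then show "?R j i" using evens(1,2)[of i] evens(1,3)[of j] by (intro path_energy_even_less)
  qed
  then have "sorted_wrt ?R (filter ?P (rev ?evens))"
    unfolding rev_filter[symmetric] sorted_wrt_rev .
  moreover have "?R i j" if "i \<in> set (filter ?P ?odds)" "j \<in> set (filter ?P (rev ?evens))" for i j
  proof -
    have "j \<in> set (filter ?P ?evens)" using that(2) by (simp only: set_filter set_rev)
    then show ?thesis using odds[OF that(1)] evens by (intro path_energy_odd_less_even)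
  qed
  ultimately show ?thesis
    unfolding chain_indices_def sorted_wrt_map filter_append sorted_wrt_append by blast
qed

end
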